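(* Let $B$ be a nonempty finite subset of $\mathbb{N}$ and let $\alpha\in(0,1]$ be a real number. Then the following statements hold: (a) There exists a set $A\subset\mathbb{N}$ such that $A$ is a union of disjoint infinite arithmetic progressions and $d(A+B)=\alpha$. (b) There exists a set $A\subset\mathbb{N}$ such that $d(A)=\alpha$, $A$ is a union of disjoint infinite arithmetic progressions, and $A$ contains infinitely many primes. (c) There exists a set $A\subset\mathbb{N}$ such that $d(A)=\alpha$, $A$ is a union of disjoint infinite arithmetic progressions, and $A$ does not contain any prime.
   Context: $\mathbb{N}$ denotes the set of positive integers and $\mathbb{N}_0$ the set of nonnegative integers. For $A,B\subset\mathbb{N}$, $A+B=\{x+y: x\in A,\ y\in B\}$. An infinite arithmetic progression is a set of the form $\{x+id: i\in\mathbb{N}_0\}$ with $x,d\in\mathbb{N}$. A nonempty set $A\subset\mathbb{N}$ is a union of disjoint infinite arithmetic progressions if it is the union of some (finite or infinite) family of pairwise disjoint infinite arithmetic progressions; the common differences may vary within the family. For $A\subset\mathbb{N}$, the upper and lower asymptotic densities are $\overline{d}(A)=\limsup_{n\to\infty}\frac{|A\cap[1,n]|}{n}$ and $\underline{d}(A)=\liminf_{n\to\infty}\frac{|A\cap[1,n]|}{n}$; if they are equal, the density $d(A)$ is said to exist and is their common value. The assertion $d(A)=\alpha$ means that the density exists and equals $\alpha$. *)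

theory Defs
  imports
    "HOL-Library.Set_Algebras"
    "HOL-Library.Disjoint_Sets"
    "HOL-Library.Extended_Real"
    "HOL-Computational_Algebra.Primes"
begin

text \<open>
  The positive integers are rendered as the subset \<open>{0<..}\<close> of type \<open>nat\<close>, and
  sumsets as the pointwise sum of \<open>HOL-Library.Set_Algebras\<close>.
\<close>

definition infinite_arith_prog :: "nat set \<Rightarrow> bool" where
  "infinite_arith_prog P \<longleftrightarrow> (\<exists>x d. 0 < x \<and> 0 < d \<and> P = {x + i * d | i. True})"

text \<open>
  Progressions are nonempty, so pairwise disjoint indexed families of them are injective and
  may be represented by plain sets of sets.
\<close>

definition union_of_disjoint_aps :: "nat set \<Rightarrow> bool" where
  "union_of_disjoint_aps A \<longleftrightarrow>
     A \<noteq> {} \<and> (\<exists>\<F>. (\<forall>P\<in>\<F>. infinite_arith_prog P) \<and> disjoint \<F> \<and> A = \<Union>\<F>)"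

text \<open>
  The densities are taken in \<open>ereal\<close>, since \<open>limsup\<close> and \<open>liminf\<close> require a complete lattice.
\<close>

definition upper_density :: "nat set \<Rightarrow> ereal" where
  "upper_density A = limsup (\<lambda>n. ereal (real (card (A \<inter> {1..n})) / real n))"

definition lower_density :: "nat set \<Rightarrow> ereal" where
  "lower_density A = liminf (\<lambda>n. ereal (real (card (A \<inter> {1..n})) / real n))"

definition has_density :: "nat set \<Rightarrow> real \<Rightarrow> bool" where
  "has_density A \<alpha> \<longleftrightarrow> upper_density A = ereal \<alpha> \<and> lower_density A = ereal \<alpha>"

end

theory Submission
  imports Defs
begin

text \<open>
  Call a set of natural numbers open if each of its elements is the start of an infinite
  arithmetic progression inside the set. A nonempty open set of positive integers is a union of
  disjoint progressions (\<open>union_of_disjoint_aps_if_ap_open\<close>): enlarging the differences suitably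
  makes any two of the progressions nested or disjoint, and the maximal ones remain. Openness is
  a local condition that survives intersections and recombination along residue classes, so only
  densities remain to be controlled.

  An open set of any density \<open>t\<close> in \<open>[0, 1]\<close> consists of the \<open>n\<close> whose exponent of \<open>2\<close> is the
  position of a digit \<open>1\<close> in the binary expansion of \<open>t\<close> (\<open>density_tends_digit_set\<close>). Distributing
  such sets over the residue classes modulo some \<open>M\<close>, with full or empty classes among them,
  gives sets whose density is the average of the parts (\<open>density_tends_interleave\<close>).

  For the sumset, fill the residue classes \<open>1, 2, ...\<close> one after the other until the density of
  \<open>A + B\<close> would pass \<open>\<alpha>\<close>, and fill the critical class only partially. For infinitely many primes,
  take a complete class modulo a large \<open>M\<close> that contains infinitely many primes and thin out the
  others. For no primes, intersect an open set of density \<open>\<alpha>\<close> with the composite numbers: these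
  form an open set, and the intersection has the same density because the primes have
  density zero, which follows from Chebyshev's estimate of the central binomial coefficient
  (\<open>primes_density_zero\<close>).
\<close>

section \<open>Natural density\<close>

text \<open>
  Densities are handled as limits of real sequences, for which the limit calculus is available.
\<close>

definition density_tends :: "nat set \<Rightarrow> real \<Rightarrow> bool" where
  "density_tends A t \<longleftrightarrow> (\<lambda>n. real (card (A \<inter> {1..n})) / real n) \<longlonglongrightarrow> t"

lemma has_density_if_density_tends:
  assumes "density_tends A t"
  shows "has_density A t"
proof -
  have "(\<lambda>n. ereal (real (card (A \<inter> {1..n})) / real n)) \<longlonglongrightarrow> ereal t"
    using assms by (simp add: density_tends_def)
  then show ?thesis
    unfolding has_density_def upper_density_def lower_density_def
    by (simp add: lim_imp_Limsup lim_imp_Liminf)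
qed

lemma density_tends_empty: "density_tends {} 0"
  by (simp add: density_tends_def)

text \<open>
  The estimates below control counting functions only up to an error of smaller order than \<open>n\<close>;
  this is what turns them into densities.
\<close>

lemma density_tends_perturb:
  fixes f e :: "nat \<Rightarrow> real"
  assumes f: "(\<lambda>n. f n / n) \<longlonglongrightarrow> t"
    and e: "(\<lambda>n. e n / n) \<longlonglongrightarrow> 0"
    and close: "\<And>n. \<bar>real (card (A \<inter> {1..n})) - f n\<bar> \<le> e n"
  shows "density_tends A t"
proof -
  have "(\<lambda>n. real (card (A \<inter> {1..n})) / n - f n / n) \<longlonglongrightarrow> 0"
  proof (rule tendsto_0_le[OF e, of _ 1], rule always_eventually, rule allI)
    fix n
    show "norm (real (card (A \<inter> {1..n})) / n - f n / n) \<le> norm (e n / n) * 1"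
      using close[of n]
      by (simp add: diff_divide_distrib[symmetric] divide_right_mono)
  qed
  from tendsto_add[OF this f] show ?thesis
    by (simp add: density_tends_def)
qed

lemma density_tends_UNIV: "density_tends UNIV 1"
proof (rule density_tends_perturb[where f = real and e = "\<lambda>_. 0"])
  show "(\<lambda>n. real n / real n) \<longlonglongrightarrow> 1"
    by (rule tendsto_eventually) (auto intro: eventually_sequentiallyI[of 1])
qed auto

lemma density_tends_UN_disjoint:
  assumes "finite I" and "disjoint_family_on A I"
    and "\<And>i. i \<in> I \<Longrightarrow> density_tends (A i) (t i)"
  shows "density_tends (\<Union>i\<in>I. A i) (\<Sum>i\<in>I. t i)"
proof -
  have "real (card ((\<Union>i\<in>I. A i) \<inter> {1..n})) / n
      = (\<Sum>i\<in>I. real (card (A i \<inter> {1..n})) / n)" for n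
  proof -
    have "card ((\<Union>i\<in>I. A i) \<inter> {1..n}) = card (\<Union>i\<in>I. A i \<inter> {1..n})"
      by (rule arg_cong[of _ _ card]) auto
    also have "\<dots> = (\<Sum>i\<in>I. card (A i \<inter> {1..n}))"
      using assms(1,2) by (intro card_UN_disjoint) (auto simp: disjoint_family_on_def)
    finally show ?thesis by (simp add: sum_divide_distrib)
  qed
  then show ?thesis
    using assms(3) unfolding density_tends_def by (simp add: tendsto_sum)
qed

lemma density_tends_nonempty:
  assumes "density_tends A t" and "0 < t"
  shows "A \<noteq> {}"
proof
  assume "A = {}"
  then have "t = 0"
    using assms(1) density_tends_empty unfolding density_tends_def by (simp add: LIMSEQ_unique)
  then show False using assms(2) by simp
qed

lemma density_tends_Int_pos:
  assumes "density_tends A t"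
  shows "density_tends (A \<inter> {0<..}) t"
proof -
  have "A \<inter> {0<..} \<inter> {1..n} = A \<inter> {1..n}" for n by auto
  then show ?thesis using assms by (simp add: density_tends_def)
qed

lemma density_tends_greaterThan: "density_tends {m<..} 1"
proof (rule density_tends_perturb[where f = real and e = "\<lambda>_. real m"])
  show "(\<lambda>n. real n / real n) \<longlonglongrightarrow> 1"
    by (rule tendsto_eventually) (auto intro: eventually_sequentiallyI[of 1])
  show "(\<lambda>n. real m / real n) \<longlonglongrightarrow> 0" by (rule lim_const_over_n)
  fix n
  have "{m<..} \<inter> {1..n} = {Suc m..n}" by auto
  then show "\<bar>real (card ({m<..} \<inter> {1..n})) - real n\<bar> \<le> real m" by auto
qed

section \<open>Interleaving sets along residue classes\<close>

lemma div_over_n_tends: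
  assumes "0 < M"
  shows "(\<lambda>n. real (n div M) / real n) \<longlonglongrightarrow> 1 / real M"
proof -
  have *: "(\<lambda>n. real (n div M) / real n - 1 / M) \<longlonglongrightarrow> 0"
  proof (rule tendsto_0_le[OF lim_const_over_n[of 1], of _ 1], rule eventually_sequentiallyI[of 1])
    fix n :: nat assume n: "1 \<le> n"
    have "real n = real M * real (n div M) + real (n mod M)"
      by (metis mult_div_mod_eq of_nat_add of_nat_mult)
    then have "real (n div M) / real n - 1 / real M = - (real (n mod M) / real M * (1 / real n))"
      using n assms by (simp add: field_simps)
    also have "\<bar>\<dots>\<bar> \<le> 1 * (1 / real n)"
    proof -
      have "real (n mod M) / real M \<le> 1" using assms by (simp add: less_imp_le)
      then have "real (n mod M) / real M * (1 / real n) \<le> 1 * (1 / real n)"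
        by (rule mult_right_mono) simp
      then show ?thesis by simp
    qed
    finally show "norm (real (n div M) / real n - 1 / real M) \<le> norm (1 / real n) * 1"
      by simp
  qed
  from tendsto_add[OF * tendsto_const[of "1/real M"]] show ?thesis by simp
qed

text \<open>
  The set that looks like a copy of \<open>S r\<close>, stretched by \<open>M\<close>, on each residue class \<open>r\<close> modulo
  \<open>M\<close>. Mixing full, empty and thinned out classes adjusts densities while leaving
  chosen classes intact.
\<close>

definition interleave :: "nat \<Rightarrow> (nat \<Rightarrow> nat set) \<Rightarrow> nat set" where
  "interleave M S = {n. n div M \<in> S (n mod M)}"

text \<open>
  Division by \<open>M\<close> maps the members up to \<open>n\<close> injectively to members of \<open>S\<close> up to \<open>n div M\<close>,
  and conversely. Only the end points are delicate: the quotient \<open>0\<close>, which the count over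
  \<open>{1..n div M}\<close> omits, and the quotient \<open>n div M\<close>, whose multiple may lie beyond \<open>n\<close> after
  adding \<open>r\<close>. Each of them costs at most one element.
\<close>

lemma density_tends_one_residue:
  assumes r: "r < M" and S: "density_tends S t"
  shows "density_tends {n. n mod M = r \<and> n div M \<in> S} (t / real M)" (is "density_tends ?E _")
proof (rule density_tends_perturb[where e = "\<lambda>_. 1"
      and f = "\<lambda>n. real (card (S \<inter> {1..n div M}))"])
  have M: "0 < M" using r by simp
  have 1: "(\<lambda>n. real (card (S \<inter> {1..n div M})) / real (n div M)) \<longlonglongrightarrow> t"
    using filterlim_compose[OF S[unfolded density_tends_def]
        filterlim_at_top_div_const_nat[OF M]] .
  have "(\<lambda>n. real (card (S \<inter> {1..n div M})) / real (n div M) * (real (n div M) / real n))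
      \<longlonglongrightarrow> t * (1 / real M)"
    by (rule tendsto_mult[OF 1 div_over_n_tends[OF M]])
  moreover have "real (card (S \<inter> {1..n div M})) / real (n div M) * (real (n div M) / real n)
      = real (card (S \<inter> {1..n div M})) / real n" for n
    by (cases "n div M = 0") auto
  ultimately have "(\<lambda>n. real (card (S \<inter> {1..n div M})) / real n) \<longlonglongrightarrow> t * (1 / real M)"
    by (simp only:)
  then show "(\<lambda>n. real (card (S \<inter> {1..n div M})) / real n) \<longlonglongrightarrow> t / real M"
    by simp
next
  show "(\<lambda>n. 1 / real n) \<longlonglongrightarrow> 0" by (rule lim_const_over_n)
next
  fix n
  have M: "0 < M" using r by simp
  let ?q = "n div M"
  have "card (?E \<inter> {1..n}) \<le> card (insert 0 (S \<inter> {1..?q}))"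
  proof (rule card_inj_on_le[of "\<lambda>n. n div M"])
    show "inj_on (\<lambda>n. n div M) (?E \<inter> {1..n})"
      by (rule inj_onI) (metis (mono_tags, lifting) IntD1 mem_Collect_eq mult_div_mod_eq)
    show "(\<lambda>n. n div M) ` (?E \<inter> {1..n}) \<subseteq> insert 0 (S \<inter> {1..?q})"
      by (auto simp: div_le_mono Suc_le_eq)
  qed simp
  then have upper: "card (?E \<inter> {1..n}) \<le> Suc (card (S \<inter> {1..?q}))"
    by (simp add: card_insert_if)
  have "card (S \<inter> {1..?q}) \<le> card (insert ?q (S \<inter> {1..<?q}))"
    by (rule card_mono) auto
  also have "\<dots> \<le> Suc (card (S \<inter> {1..<?q}))"
    by (simp add: card_insert_if)
  also have "card (S \<inter> {1..<?q}) \<le> card (?E \<inter> {1..n})"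
  proof (rule card_inj_on_le[of "\<lambda>q. M * q + r"])
    show "inj_on (\<lambda>q. M * q + r) (S \<inter> {1..<?q})"
      using M by (auto simp: inj_on_def)
    show "(\<lambda>q. M * q + r) ` (S \<inter> {1..<?q}) \<subseteq> ?E \<inter> {1..n}"
    proof
      fix x assume "x \<in> (\<lambda>q. M * q + r) ` (S \<inter> {1..<?q})"
      then obtain q where q: "q \<in> S" "1 \<le> q" "Suc q \<le> ?q" "x = M * q + r" by auto
      have "M * Suc q \<le> M * ?q" using q(3) by (rule mult_le_mono2)
      also have "\<dots> \<le> n" by simp
      finally have "x \<le> n" using q r by simp
      moreover have "1 \<le> x" using q M by (simp add: Suc_le_eq)
      ultimately show "x \<in> ?E \<inter> {1..n}" using q r by simp
    qed
  qed simp
  finally show "\<bar>real (card (?E \<inter> {1..n})) - real (card (S \<inter> {1..?q}))\<bar> \<le> 1"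
    using upper by simp
qed

lemma density_tends_interleave:
  assumes "0 < M" and "\<And>r. r < M \<Longrightarrow> density_tends (S r) (t r)"
  shows "density_tends (interleave M S) ((\<Sum>r<M. t r) / real M)"
proof -
  have "density_tends (\<Union>r\<in>{..<M}. {n. n mod M = r \<and> n div M \<in> S r}) (\<Sum>r\<in>{..<M}. t r / real M)"
    using assms by (intro density_tends_UN_disjoint density_tends_one_residue)
      (auto simp: disjoint_family_on_def)
  moreover have "(\<Union>r\<in>{..<M}. {n. n mod M = r \<and> n div M \<in> S r}) = interleave M S"
    using assms(1) by (auto simp: interleave_def)
  ultimately show ?thesis by (simp add: sum_divide_distrib)
qed

section \<open>Sets open under arithmetic progressions\<close>

text \<open>
  The progressions inside \<open>A\<close> may overlap, so the property is checked one element at a time and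
  passes to intersections and interleavings without the choice of a family of progressions.
\<close>

definition ap_open :: "nat set \<Rightarrow> bool" where
  "ap_open A \<longleftrightarrow> (\<forall>a\<in>A. \<exists>d>0. \<forall>i. a + i * d \<in> A)"

lemma ap_open_empty: "ap_open {}" and ap_open_UNIV: "ap_open UNIV"
  by (auto simp: ap_open_def)

lemma ap_open_pos: "ap_open {0<..}"
  by (auto simp: ap_open_def)

lemma ap_open_Int:
  assumes "ap_open A" and "ap_open B"
  shows "ap_open (A \<inter> B)"
  unfolding ap_open_def
proof
  fix a assume a: "a \<in> A \<inter> B"
  from a assms obtain d e where d: "0 < d" "\<And>i. a + i * d \<in> A" and e: "0 < e" "\<And>i. a + i * e \<in> B"
    unfolding ap_open_def by blast
  have "a + i * (d * e) \<in> A \<inter> B" for i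
    using d(2)[of "i * e"] e(2)[of "i * d"] by (simp add: ac_simps)
  then show "\<exists>d>0. \<forall>i. a + i * d \<in> A \<inter> B" using d(1) e(1) by (metis nat_0_less_mult_iff)
qed

lemma ap_open_interleave:
  assumes "0 < M" and "\<And>r. ap_open (S r)"
  shows "ap_open (interleave M S)"
  unfolding ap_open_def
proof
  fix n assume n: "n \<in> interleave M S"
  with assms(2)[of "n mod M"] obtain d
    where d: "0 < d" "\<And>i. n div M + i * d \<in> S (n mod M)"
    unfolding interleave_def ap_open_def by blast
  have "n + i * (d * M) \<in> interleave M S" for i
  proof -
    have "n + i * (d * M) = n + (i * d) * M" by simp
    then have "(n + i * (d * M)) div M = n div M + i * d" "(n + i * (d * M)) mod M = n mod M"
      using assms(1) by (simp_all only: div_mult_self1 mod_mult_self1 add.commute)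
    then show ?thesis using d(2)[of i] by (simp add: interleave_def)
  qed
  then show "\<exists>d>0. \<forall>i. n + i * d \<in> interleave M S"
    using d(1) assms(1) by (intro exI[of _ "d * M"]) auto
qed

text \<open>
  Let \<open>d a\<close> be a difference of a progression in \<open>A\<close> starting at \<open>a\<close>. Replace it by the product
  \<open>L a\<close> of the differences of all elements of \<open>A\<close> up to \<open>a\<close>, and let \<open>P a\<close> be the
  progression from \<open>a\<close> with difference \<open>L a\<close>. For \<open>m \<le> n\<close> the number \<open>L m\<close> divides \<open>L n\<close>, so
  as soon as \<open>P m\<close> and \<open>P n\<close> meet, \<open>L m\<close> divides \<open>n - m\<close>, and therefore \<open>P n\<close> lies in \<open>P m\<close>.
  Any two of these progressions are thus nested or disjoint, and the maximal ones partition \<open>A\<close>.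
\<close>

lemma union_of_disjoint_aps_if_ap_open:
  assumes ne: "A \<noteq> {}" and pos: "A \<subseteq> {0<..}" and opn: "ap_open A"
  shows "union_of_disjoint_aps A"
proof -
  from opn obtain d where d: "\<And>a. a \<in> A \<Longrightarrow> 0 < d a" "\<And>a i. a \<in> A \<Longrightarrow> a + i * d a \<in> A"
    unfolding ap_open_def by metis
  define L where "L n = (\<Prod>m\<in>A \<inter> {..n}. d m)" for n
  define P where "P n = {n + i * L n | i. True}" for n
  have L_pos: "0 < L n" for n
    unfolding L_def by (rule prod_pos) (use d(1) in auto)
  have L_dvd: "L m dvd L n" if "m \<le> n" for m n
    unfolding L_def using that by (intro prod_dvd_prod_subset) auto
  have self: "n \<in> P n" for n
    unfolding P_def by (auto intro: exI[of _ 0])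
  have ge: "n \<le> x" if "x \<in> P n" for x n
    using that by (auto simp: P_def)
  have mem_P: "x \<in> P n \<longleftrightarrow> n \<le> x \<and> L n dvd x - n" for x n
  proof
    assume "x \<in> P n"
    then show "n \<le> x \<and> L n dvd x - n" by (auto simp: P_def)
  next
    assume *: "n \<le> x \<and> L n dvd x - n"
    then obtain k where "x - n = L n * k" by (auto elim: dvdE)
    then show "x \<in> P n" using * unfolding P_def by (auto intro!: exI[of _ k] simp: mult.commute)
  qed
  have sub_A: "P n \<subseteq> A" if "n \<in> A" for n
  proof
    fix x assume "x \<in> P n"
    then obtain i where x: "x = n + i * L n" by (auto simp: P_def)
    have "d n dvd L n"
      unfolding L_def using that by (intro dvd_prodI) auto
    then obtain k where "L n = d n * k" by (auto elim: dvdE)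
    then have "x = n + (i * k) * d n" using x by simp
    then show "x \<in> A" using d(2)[OF that] by simp
  qed
  have laminar: "P n \<subseteq> P m" if "m \<le> n" "P m \<inter> P n \<noteq> {}" for m n
  proof -
    from that(2) obtain x where x: "x \<in> P m" "x \<in> P n" by blast
    have "L m dvd x - n" using x(2) L_dvd[OF that(1)] mem_P dvd_trans by blast
    moreover have "L m dvd x - m" using x(1) mem_P by blast
    moreover have "x - m = (x - n) + (n - m)" using that(1) ge[OF x(2)] by simp
    ultimately have nm: "L m dvd n - m" by (metis dvd_add_right_iff)
    show ?thesis
    proof
      fix y assume y: "y \<in> P n"
      then have "L m dvd y - n" using L_dvd[OF that(1)] mem_P dvd_trans by blast
      moreover have "y - m = (y - n) + (n - m)" using that(1) ge[OF y] by simp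
      ultimately have "L m dvd y - m" using nm by (metis dvd_add)
      then show "y \<in> P m" using ge[OF y] that(1) by (simp add: mem_P)
    qed
  qed
  \<comment> \<open>\<open>P n\<close> is maximal exactly if no earlier progression contains its first element.\<close>
  define T where "T = {n \<in> A. \<forall>m\<in>A. m < n \<longrightarrow> n \<notin> P m}"
  have "infinite_arith_prog X" if "X \<in> P ` T" for X
    using that pos L_pos unfolding infinite_arith_prog_def P_def T_def by blast
  moreover have "disjoint (P ` T)"
  proof -
    have "P m \<inter> P n = {}" if "m \<in> T" "n \<in> T" "m < n" for m n
      using that laminar[of m n] self[of n] unfolding T_def by auto
    then have "P m \<inter> P n = {}" if "m \<in> T" "n \<in> T" "m \<noteq> n" for m n
      using that by (metis Int_commute linorder_neqE_nat)
    then show ?thesis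
      unfolding pairwise_def disjnt_def by fastforce
  qed
  moreover have "A = \<Union>(P ` T)"
  proof
    show "\<Union>(P ` T) \<subseteq> A" using sub_A unfolding T_def by auto
    show "A \<subseteq> \<Union>(P ` T)"
    proof
      fix n assume n: "n \<in> A"
      \<comment> \<open>The first progression through \<open>n\<close> is a maximal one.\<close>
      define m where "m = (LEAST m. m \<in> A \<and> n \<in> P m)"
      have m: "m \<in> A \<and> n \<in> P m"
        unfolding m_def by (rule LeastI[of _ n]) (use n self in blast)
      have "m \<notin> P k" if "k \<in> A" "k < m" for k
      proof
        assume "m \<in> P k"
        then have "P m \<subseteq> P k" using laminar[of k m] that(2) self[of m] by auto
        then have "n \<in> P k" using m by blast
        then have "m \<le> k" unfolding m_def using that(1) by (intro Least_le) blast
        then show False using that(2) by simp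
      qed
      then have "m \<in> T" using m by (simp add: T_def)
      then show "n \<in> \<Union>(P ` T)" using m by blast
    qed
  qed
  ultimately show ?thesis
    unfolding union_of_disjoint_aps_def using ne by (intro conjI exI[of _ "P ` T"]) blast+
qed

section \<open>Open sets of prescribed density\<close>

text \<open>
  For \<open>t\<close> in \<open>[0, 1]\<close> and \<open>n = 2^k * u\<close> with \<open>u\<close> odd, the predicate says that the \<open>k\<close>-th binary
  digit of \<open>t\<close> after the point (counted from \<open>0\<close>) is \<open>1\<close>, where \<open>t = 1\<close> has the expansion
  \<open>0.111...\<close>. The numbers with exponent \<open>k\<close> have density \<open>1 / 2^(k+1)\<close>, the weight of that digit.
  The recursion shifts the expansion by one digit, which avoids any theory of binary expansions
  and yields the recursion for the counting function that the error estimate needs.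
\<close>

fun digit_member :: "real \<Rightarrow> nat \<Rightarrow> bool" where
  "digit_member t n \<longleftrightarrow>
     (if n = 0 then False
      else if odd n then 1 / 2 \<le> t
      else digit_member (if 1 / 2 \<le> t then 2 * t - 1 else 2 * t) (n div 2))"

declare digit_member.simps [simp del]

definition digit_set :: "real \<Rightarrow> nat set" where
  "digit_set t = {n. digit_member t n}"

text \<open>
  Membership depends only on the exponent of \<open>2\<close> in \<open>n\<close>, and \<open>n\<close> is multiplied by the odd number
  \<open>1 + 2 * i\<close>.
\<close>

lemma digit_member_mult:
  "digit_member t n \<Longrightarrow> digit_member t (n + i * (2 * n))"
proof (induction t n rule: digit_member.induct)
  case (1 t n)
  have n: "n \<noteq> 0" using 1(2) by (subst (asm) digit_member.simps) (auto split: if_splits)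
  show ?case
  proof (cases "odd n")
    case True
    then show ?thesis using 1(2) n
      by (simp add: digit_member.simps[of t n] digit_member.simps[of t "n + i * (2 * n)"])
  next
    case False
    then obtain k where k: "n = 2 * k" by (auto elim: evenE)
    have "(n + i * (2 * n)) div 2 = n div 2 + i * (2 * (n div 2))" "even (n + i * (2 * n))"
      unfolding k by (simp_all add: algebra_simps)
    then show ?thesis using 1 n False
      by (simp add: digit_member.simps[of t n] digit_member.simps[of t "n + i * (2 * n)"])
  qed
qed

lemma ap_open_digit_set: "ap_open (digit_set t)"
  unfolding ap_open_def
proof
  fix n assume n: "n \<in> digit_set t"
  then have "n \<noteq> 0"
    unfolding digit_set_def
    by (subst (asm) mem_Collect_eq, subst (asm) digit_member.simps) (auto split: if_splits)
  then show "\<exists>d>0. \<forall>i. n + i * d \<in> digit_set t"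
    using n digit_member_mult by (intro exI[of _ "2 * n"]) (auto simp: digit_set_def)
qed

lemma card_odd_upto: "card {m. odd m \<and> m \<in> {1..n}} = (n + 1) div 2"
proof (induction n)
  case 0
  have "{m. odd m \<and> m \<in> {1..0::nat}} = {}" by auto
  then show ?case by (metis card.empty div_less one_less_numeral_iff semiring_norm(76) add_0)
next
  case (Suc n)
  have "{m. odd m \<and> m \<in> {1..Suc n}} =
    (if odd (Suc n) then insert (Suc n) {m. odd m \<and> m \<in> {1..n}} else {m. odd m \<and> m \<in> {1..n}})"
    by (auto simp: le_Suc_eq)
  then show ?case using Suc by (auto elim!: evenE oddE)
qed

lemma card_digit_set_upto:
  "card (digit_set t \<inter> {1..n}) = (if 1 / 2 \<le> t then (n + 1) div 2 else 0)
     + card (digit_set (if 1 / 2 \<le> t then 2 * t - 1 else 2 * t) \<inter> {1..n div 2})"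
    (is "_ = _ + card (digit_set ?t' \<inter> _)")
proof -
  let ?O = "if 1 / 2 \<le> t then {m. odd m \<and> m \<in> {1..n}} else {}"
  let ?E = "(\<lambda>m. 2 * m) ` (digit_set ?t' \<inter> {1..n div 2})"
  have split: "digit_set t \<inter> {1..n} = ?O \<union> ?E"
  proof (rule set_eqI)
    fix m
    show "m \<in> digit_set t \<inter> {1..n} \<longleftrightarrow> m \<in> ?O \<union> ?E"
    proof (cases "odd m")
      case True
      then have "m \<notin> ?E" "m > 0" by (auto elim: oddE)
      then show ?thesis using True by (simp add: digit_set_def digit_member.simps[of t m])
    next
      case False
      then obtain k where k: "m = 2 * k" by (auto elim: evenE)
      then show ?thesis
        by (auto simp: digit_set_def digit_member.simps[of t "2 * k"] image_iff)
    qed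
  qed
  have "card (?O \<union> ?E) = card ?O + card ?E"
    by (intro card_Un_disjoint) auto
  moreover have "card ?E = card (digit_set ?t' \<inter> {1..n div 2})"
    by (rule card_image) (auto simp: inj_on_def)
  moreover have "card ?O = (if 1 / 2 \<le> t then (n + 1) div 2 else 0)"
    using card_odd_upto[of n] by (simp only: if_distrib[of card] card.empty split: if_split)
  ultimately show ?thesis unfolding split by (simp only:)
qed

text \<open>
  With \<open>t = (b + t') / 2\<close>, where \<open>b\<close> is the first digit, the error at \<open>n\<close> is that of \<open>t'\<close> at
  \<open>n div 2\<close> plus a rounding term of size at most \<open>1 / 2\<close>. The error is therefore logarithmic; the
  weaker square root bound makes the induction short and is of smaller order than \<open>n\<close> as well.
\<close>

lemma card_digit_set_error:
  assumes "0 \<le> t" and "t \<le> 1"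
  shows "\<bar>real (card (digit_set t \<inter> {1..n})) - t * real n\<bar> \<le> 2 * sqrt (real n)"
  using assms
proof (induction n arbitrary: t rule: less_induct)
  case (less n)
  show ?case
  proof (cases "n = 0")
    case True
    then show ?thesis by simp
  next
    case False
    define b :: real where "b = (if 1 / 2 \<le> t then 1 else 0)"
    define t' where "t' = (if 1 / 2 \<le> t then 2 * t - 1 else 2 * t)"
    define m where "m = n div 2"
    have t: "t = (b + t') / 2" and t': "0 \<le> t'" "t' \<le> 1"
      using less.prems by (auto simp: b_def t'_def)
    have IH: "\<bar>real (card (digit_set t' \<inter> {1..m})) - t' * real m\<bar> \<le> 2 * sqrt (real m)"
      using False t' by (intro less.IH) (auto simp: m_def)
    have count: "real (card (digit_set t \<inter> {1..n}))
        = b * real ((n + 1) div 2) + real (card (digit_set t' \<inter> {1..m}))"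
      by (subst card_digit_set_upto) (simp add: b_def t'_def m_def)
    have step: "\<bar>b * real ((n + 1) div 2) + t' * real m - t * real n\<bar> \<le> 1 / 2"
    proof (cases "even n")
      case True
      then obtain k where "n = 2 * k" by (auto elim: evenE)
      then have "b * real ((n + 1) div 2) + t' * real m - t * real n = 0"
        by (simp add: t m_def field_simps)
      then show ?thesis by simp
    next
      case False
      then obtain k where k: "n = 2 * k + 1" by (auto elim: oddE)
      have "b * real ((n + 1) div 2) + t' * real m - t * real n = (b - t') / 2"
        unfolding k m_def t by (simp add: field_simps)
      moreover have "\<bar>(b - t') / 2\<bar> \<le> 1 / 2" using t' by (auto simp: b_def)
      ultimately show ?thesis by (simp only:)
    qed
    \<comment> \<open>\<open>3 / 4\<close> is a rational upper bound of \<open>sqrt (1 / 2)\<close>.\<close>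
    have "sqrt (real m) \<le> sqrt ((3/4)^2 * real n)"
      by (rule real_sqrt_le_mono) (auto simp: m_def power2_eq_square)
    then have "sqrt (real m) \<le> 3 / 4 * sqrt (real n)"
      by (simp add: real_sqrt_mult)
    moreover have "1 \<le> sqrt (real n)" using False by simp
    ultimately have "2 * sqrt (real m) + 1 / 2 \<le> 2 * sqrt (real n)" by linarith
    then show ?thesis using IH step count by linarith
  qed
qed

lemma density_tends_digit_set:
  assumes "0 \<le> t" and "t \<le> 1"
  shows "density_tends (digit_set t) t"
proof (rule density_tends_perturb[OF _ _ card_digit_set_error[OF assms]])
  show "(\<lambda>n. t * real n / real n) \<longlonglongrightarrow> t"
    by (rule tendsto_eventually, rule eventually_sequentiallyI[of 1]) simp
  have "(\<lambda>n. 2 * (1 / sqrt (real n))) \<longlonglongrightarrow> 2 * 0"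
    by (intro tendsto_mult tendsto_const tendsto_divide_0[OF tendsto_const]
        filterlim_at_top_imp_at_infinity filterlim_compose[OF sqrt_at_top filterlim_real_sequentially])
  moreover have "2 * sqrt (real n) / real n = 2 * (1 / sqrt (real n))" for n
    by (cases "n = 0") (simp_all add: field_simps)
  ultimately show "(\<lambda>n. 2 * sqrt (real n) / real n) \<longlonglongrightarrow> 0" by simp
qed

section \<open>Primes have density zero\<close>

lemma prod_primes_dvd:
  fixes m :: nat
  assumes "finite Q" and "\<And>p. p \<in> Q \<Longrightarrow> prime p \<and> p dvd m"
  shows "\<Prod>Q dvd m"
  using assms
proof (induction Q rule: finite_induct)
  case (insert p Q)
  have "coprime p (\<Prod>Q)"
    using insert by (intro prod_coprime_right) (metis insertCI primes_coprime)
  then show ?case using insert by (simp add: divides_mult)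
qed simp

text \<open>
  The argument of Chebyshev: the primes in question all divide the central binomial coefficient
  \<open>(2 * n) choose n\<close>, which is at most \<open>2 ^ (2 * n)\<close>, while each of them exceeds \<open>2 ^ K\<close>.
\<close>

lemma card_primes_between:
  assumes n: "2 ^ K \<le> n"
  shows "K * card {p. prime p \<and> n < p \<and> p \<le> 2 * n} \<le> 2 * n"
proof -
  let ?Q = "{p. prime p \<and> n < p \<and> p \<le> 2 * n}"
  have fin: "finite ?Q" by (rule finite_subset[of _ "{..2 * n}"]) auto
  have "p dvd ((2 * n) choose n)" if p: "p \<in> ?Q" for p
  proof -
    have "fact n * fact n * ((2 * n) choose n) = fact (2 * n)"
      using binomial_fact_lemma[of n "2 * n"] by (simp add: mult_2)
    moreover have "p dvd fact (2 * n)" using p by (simp add: prime_dvd_fact_iff)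
    ultimately have "p dvd fact n * fact n * ((2 * n) choose n)" by metis
    then show ?thesis using p by (simp add: prime_dvd_mult_iff prime_dvd_fact_iff)
  qed
  then have "\<Prod>?Q dvd ((2 * n) choose n)"
    using fin by (intro prod_primes_dvd) auto
  then have "\<Prod>?Q \<le> ((2 * n) choose n)"
    by (rule dvd_imp_le) simp
  also have "\<dots> \<le> 2 ^ (2 * n)" by (rule binomial_le_pow2)
  finally have upper: "\<Prod>?Q \<le> 2 ^ (2 * n)" .
  have "(2::nat) ^ (K * card ?Q) = (\<Prod>p\<in>?Q. 2 ^ K)"
    by (simp add: power_mult)
  also have "\<dots> \<le> \<Prod>?Q"
    using n by (intro prod_mono) auto
  also note upper
  finally show ?thesis by (rule power_le_imp_le_exp[rotated]) simp
qed

text \<open>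
  Halving \<open>n\<close> (rounded up) and applying the previous estimate gives a geometric series for the
  number of primes. The additive constant covers the \<open>n\<close> whose half is below \<open>2 ^ K\<close>; the factor
  \<open>8\<close> exceeds the true sum of the series by enough to absorb the rounding.
\<close>

lemma card_primes_upto_le:
  assumes "0 < K"
  shows "real (card {p. prime p \<and> p \<le> n}) \<le> (2 * 2 ^ K + 2) + 8 * real n / real K"
proof (induction n rule: less_induct)
  case (less n)
  show ?case
  proof (cases "n < 2 * 2 ^ K + 2")
    case True
    have "card {p. prime p \<and> p \<le> n} \<le> card {1..n}"
      by (rule card_mono) (auto simp: prime_gt_0_nat Suc_le_eq)
    then have "card {p. prime p \<and> p \<le> n} \<le> 2 * 2 ^ K + 2"
      using True by simp
    then have "real (card {p. prime p \<and> p \<le> n}) \<le> real (2 * 2 ^ K + 2)"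
      by (simp only: of_nat_le_iff)
    moreover have "0 \<le> 8 * real n / real K" by simp
    ultimately show ?thesis by (simp add: add_increasing2)
  next
    case False
    define m where "m = (n + 1) div 2"
    have m: "m < n" "2 ^ K \<le> m" "n \<le> 2 * m" "2 * m \<le> n + 1"
      using False by (auto simp: m_def)
    have "card {p. prime p \<and> p \<le> n}
        \<le> card ({p. prime p \<and> p \<le> m} \<union> {p. prime p \<and> m < p \<and> p \<le> 2 * m})"
    proof (rule card_mono)
      show "finite ({p. prime p \<and> p \<le> m} \<union> {p. prime p \<and> m < p \<and> p \<le> 2 * m})"
        by (rule finite_subset[of _ "{..2 * m}"]) auto
      show "{p. prime p \<and> p \<le> n}
          \<subseteq> {p. prime p \<and> p \<le> m} \<union> {p. prime p \<and> m < p \<and> p \<le> 2 * m}"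
        using m(3) by auto
    qed
    also have "\<dots> \<le> card {p. prime p \<and> p \<le> m} + card {p. prime p \<and> m < p \<and> p \<le> 2 * m}"
      by (rule card_Un_le)
    finally have "real (card {p. prime p \<and> p \<le> n})
      \<le> real (card {p. prime p \<and> p \<le> m}) + real (card {p. prime p \<and> m < p \<and> p \<le> 2 * m})"
      by linarith
    moreover have "real (card {p. prime p \<and> p \<le> m}) \<le> (2 * 2 ^ K + 2) + 8 * real m / real K"
      by (rule less.IH[OF m(1)])
    moreover have "real (card {p. prime p \<and> m < p \<and> p \<le> 2 * m}) \<le> 2 * real m / real K"
    proof -
      have "real (K * card {p. prime p \<and> m < p \<and> p \<le> 2 * m}) \<le> real (2 * m)"
        using card_primes_between[OF m(2)] by (simp only: of_nat_le_iff)
      then show ?thesis using assms by (simp add: field_simps)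
    qed
    moreover have "8 * real m / real K + 2 * real m / real K \<le> 8 * real n / real K"
    proof -
      have "8 * real m + 2 * real m \<le> 8 * real n" using m(4) False by simp
      then show ?thesis by (simp add: add_divide_distrib[symmetric] divide_right_mono)
    qed
    ultimately show ?thesis by linarith
  qed
qed

lemma primes_density_zero:
  "(\<lambda>n. real (card {p. prime p \<and> p \<le> n}) / real n) \<longlonglongrightarrow> 0"
proof (rule LIMSEQ_I)
  fix \<epsilon> :: real assume \<epsilon>: "0 < \<epsilon>"
  obtain K :: nat where K: "16 / \<epsilon> < real K" using reals_Archimedean2 by blast
  have K0: "0 < K" using K \<epsilon> by (cases K) (auto simp: field_simps)
  define C :: real where "C = 2 * 2 ^ K + 2"
  obtain N :: nat where N: "2 * C / \<epsilon> < real N" using reals_Archimedean2 by blast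
  show "\<exists>no. \<forall>n\<ge>no. norm (real (card {p. prime p \<and> p \<le> n}) / real n - 0) < \<epsilon>"
  proof (intro exI[of _ "N + 1"] allI impI)
    fix n assume n: "N + 1 \<le> n"
    have "2 * C / \<epsilon> < real n" using N n by linarith
    then have "C < \<epsilon> / 2 * real n" using \<epsilon> by (simp add: field_simps)
    moreover have "8 * real n / real K \<le> \<epsilon> / 2 * real n"
    proof -
      have "8 / real K \<le> \<epsilon> / 2" using K K0 \<epsilon> by (simp add: field_simps)
      from mult_right_mono[OF this, of "real n"] show ?thesis by simp
    qed
    moreover have "real (card {p. prime p \<and> p \<le> n}) \<le> C + 8 * real n / real K"
      using card_primes_upto_le[OF K0] by (simp add: C_def)
    ultimately have "real (card {p. prime p \<and> p \<le> n}) < \<epsilon> * real n" by linarith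
    then show "norm (real (card {p. prime p \<and> p \<le> n}) / real n - 0) < \<epsilon>"
      using n by (simp add: field_simps)
  qed
qed

section \<open>A sumset of prescribed density\<close>

text \<open>
  A discrete intermediate value argument: the least \<open>k\<close> for which \<open>{1..k} + B\<close> has at least \<open>y\<close>
  elements is positive, and \<open>j\<close> is its predecessor.
\<close>

lemma sumset_greedy_step:
  fixes B :: "nat set" and y :: real
  assumes "finite B" and "0 < y" and "y \<le> real (card ({1..J} + B))"
  obtains j where "j < J" and "real (card ({1..j} + B)) < y" and "y \<le> real (card ({1..Suc j} + B))"
proof -
  define c where "c j = real (card ({1..j} + B))" for j
  have c0: "\<not> y \<le> c 0" using assms(2) by (simp add: c_def)
  define k where "k = (LEAST j. y \<le> c j)"
  have k: "y \<le> c k" "k \<le> J"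
    unfolding k_def using assms(3) by (auto simp: c_def intro: LeastI Least_le)
  then obtain j where j: "k = Suc j" using c0 by (cases k) auto
  have "\<not> y \<le> c j" using not_less_Least[of j "\<lambda>j. y \<le> c j"] j by (simp add: k_def)
  then show thesis using that[of j] j k by (simp add: c_def)
qed

text \<open>
  If adding \<open>b\<close> to an occupied residue never carries into the quotient, then the sumset is governed
  by addition of residues alone.
\<close>

lemma interleave_plus:
  assumes M: "\<And>r b. r < M \<Longrightarrow> S r \<noteq> {} \<Longrightarrow> b \<in> B \<Longrightarrow> r + b < M" and "0 < M"
  shows "interleave M S + B = interleave M (\<lambda>s. \<Union>r\<in>{r. \<exists>b\<in>B. s = r + b}. S r)"
proof (rule set_eqI)
  fix n
  show "n \<in> interleave M S + B
    \<longleftrightarrow> n \<in> interleave M (\<lambda>s. \<Union>r\<in>{r. \<exists>b\<in>B. s = r + b}. S r)"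
  proof
    assume "n \<in> interleave M S + B"
    then obtain a b where ab: "n = a + b" "a div M \<in> S (a mod M)" "b \<in> B"
      by (auto simp: set_plus_def interleave_def)
    have lt: "a mod M + b < M" using ab assms by (intro M) auto
    have "n = (a mod M + b) + (a div M) * M" using ab(1) by simp
    then have "n div M = a div M" "n mod M = a mod M + b"
      using lt by (simp_all only: div_mult_self1 mod_mult_self1 div_less mod_less)
    then show "n \<in> interleave M (\<lambda>s. \<Union>r\<in>{r. \<exists>b\<in>B. s = r + b}. S r)"
      using ab by (auto simp: interleave_def)
  next
    assume "n \<in> interleave M (\<lambda>s. \<Union>r\<in>{r. \<exists>b\<in>B. s = r + b}. S r)"
    then obtain r b where rb: "b \<in> B" "n mod M = r + b" "n div M \<in> S r"
      by (auto simp: interleave_def)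
    have r: "r < M" using rb(2) \<open>0 < M\<close> by (metis add_lessD1 mod_less_divisor)
    define a where "a = r + (n div M) * M"
    have "a div M = n div M" "a mod M = r"
      unfolding a_def using r by simp_all
    then have "a \<in> interleave M S" using rb(3) by (simp add: interleave_def)
    moreover have "n = a + b"
      using rb(2) unfolding a_def by (metis add.commute add.left_commute div_mult_mod_eq)
    ultimately show "n \<in> interleave M S + B" using rb(1) by (auto simp: set_plus_def)
  qed
qed

text \<open>
  Since \<open>\<alpha> < 1\<close>, for a large modulus \<open>M\<close> the residues \<open>{1..J}\<close> that can be shifted by \<open>B\<close>
  without reaching \<open>M\<close> number at least \<open>\<alpha> * M\<close>. Fill the classes \<open>1, ..., j\<close> completely for the
  last \<open>j\<close> such that the sumset has density below \<open>\<alpha>\<close>. Filling the class \<open>j + 1\<close> as well would add the set \<open>N\<close> of new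
  classes to the sumset and reach \<open>\<alpha>\<close>; filling it only with density \<open>\<delta>\<close> gives each class in \<open>N\<close>
  the relative density \<open>\<delta>\<close>, because a new class arises from the residue \<open>j + 1\<close> alone. A suitable
  \<open>\<delta>\<close> hits \<open>\<alpha>\<close> exactly.
\<close>

lemma exists_ap_open_sumset_density:
  fixes B :: "nat set"
  assumes B: "B \<noteq> {}" "finite B" and \<alpha>: "0 < \<alpha>" "\<alpha> < 1"
  shows "\<exists>A\<subseteq>{0<..}. ap_open A \<and> density_tends (A + B) \<alpha>"
proof -
  define b where "b = Max B"
  have b: "b \<in> B" "\<And>x. x \<in> B \<Longrightarrow> x \<le> b" using B by (auto simp: b_def)
  obtain M0 :: nat where M0: "real (b + 1) / (1 - \<alpha>) < real M0" using reals_Archimedean2 by blast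
  define M where "M = M0 + b + 2"
  have M: "0 < M" "b + 1 < M" by (auto simp: M_def)
  define J where "J = M - b - 1"
  have "real (b + 1) / (1 - \<alpha>) < real M" using M0 unfolding M_def by linarith
  then have "real (b + 1) < real M * (1 - \<alpha>)" using \<alpha> by (simp add: field_simps)
  then have aM: "\<alpha> * real M \<le> real J" using M by (simp add: J_def of_nat_diff algebra_simps)
  have "card {1..J} = card ((\<lambda>x. x + b) ` {1..J})" by (simp add: card_image)
  also have "\<dots> \<le> card ({1..J} + B)"
  proof (rule card_mono)
    show "finite ({1..J} + B)" using B(2) by (simp add: finite_set_plus)
    show "(\<lambda>x. x + b) ` {1..J} \<subseteq> {1..J} + B"
      using b(1) by (intro image_subsetI set_plus_intro)
  qed
  finally have "\<alpha> * real M \<le> real (card ({1..J} + B))" using aM by simp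
  then obtain j where j: "j < J" "real (card ({1..j} + B)) < \<alpha> * real M"
      "\<alpha> * real M \<le> real (card ({1..Suc j} + B))"
    using sumset_greedy_step[OF B(2), of "\<alpha> * real M" J] \<alpha> M by auto
  define R where "R = {1..j} + B"
  define N where "N = ({1..Suc j} + B) - R"
  have fin: "finite R" "finite N" using B by (auto simp: R_def N_def intro: finite_set_plus)
  have R_sub: "R \<subseteq> {1..Suc j} + B" unfolding R_def by (auto simp: set_plus_def)
  have card_RN: "card ({1..Suc j} + B) = card R + card N"
    using R_sub fin card_Un_disjoint[of R N] unfolding N_def by (simp add: Un_absorb1)
  \<comment> \<open>The solution of \<open>card R + card N * \<delta> = \<alpha> * M\<close>.\<close>
  define \<delta> where "\<delta> = (\<alpha> * real M - real (card R)) / real (card N)"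
  have N_pos: "0 < card N" using j(2,3) card_RN by (auto simp: R_def)
  have \<delta>: "0 \<le> \<delta>" "\<delta> \<le> 1"
    using j(2,3) card_RN N_pos by (auto simp: \<delta>_def R_def field_simps)
  define S where "S r = (if r \<in> {1..j} then UNIV else if r = Suc j then digit_set \<delta> else {})" for r
  define S' where "S' s = (if s \<in> R then UNIV else if s \<in> N then digit_set \<delta> else {})" for s
  have lt: "r + x < M" if "r \<in> {1..Suc j}" "x \<in> B" for r x
    using that b(2)[of x] j(1) by (auto simp: J_def)
  have "interleave M S + B = interleave M (\<lambda>s. \<Union>r\<in>{r. \<exists>b\<in>B. s = r + b}. S r)"
  proof (rule interleave_plus)
    fix r x assume "S r \<noteq> {}" and "x \<in> B"
    then show "r + x < M" by (intro lt) (auto simp: S_def split: if_splits)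
  qed (rule M(1))
  also have "(\<lambda>s. \<Union>r\<in>{r. \<exists>b\<in>B. s = r + b}. S r) = S'"
  proof
    fix s
    have R_iff: "s \<in> R \<longleftrightarrow> (\<exists>r\<in>{1..j}. \<exists>b\<in>B. s = r + b)" by (auto simp: R_def set_plus_def)
    have N_iff: "s \<in> N \<longleftrightarrow> s \<notin> R \<and> (\<exists>b\<in>B. s = Suc j + b)"
      by (fastforce simp: N_def R_def set_plus_def atLeastAtMostSuc_conv)
    show "(\<Union>r\<in>{r. \<exists>b\<in>B. s = r + b}. S r) = S' s"
    proof (cases "s \<in> R")
      case True
      then obtain r where "r \<in> {1..j}" "\<exists>b\<in>B. s = r + b" using R_iff by blast
      then have "S r = UNIV" "r \<in> {r. \<exists>b\<in>B. s = r + b}" by (auto simp: S_def)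
      then have "(\<Union>r\<in>{r. \<exists>b\<in>B. s = r + b}. S r) = UNIV" by blast
      then show ?thesis using True by (simp add: S'_def)
    next
      case False
      then have "S r = (if r = Suc j then digit_set \<delta> else {})" if "\<exists>b\<in>B. s = r + b" for r
        using R_iff that by (auto simp: S_def)
      then have "(\<Union>r\<in>{r. \<exists>b\<in>B. s = r + b}. S r)
          = (\<Union>r\<in>{r. \<exists>b\<in>B. s = r + b}. if r = Suc j then digit_set \<delta> else {})"
        by (intro SUP_cong) auto
      also have "\<dots> = (if \<exists>b\<in>B. s = Suc j + b then digit_set \<delta> else {})" by auto
      finally show ?thesis using False N_iff by (simp add: S'_def)
    qed
  qed
  finally have sum: "interleave M S + B = interleave M S'" .
  have "density_tends (interleave M S')
      ((\<Sum>s<M. if s \<in> R then 1 else if s \<in> N then \<delta> else 0) / real M)"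
    using M density_tends_digit_set[OF \<delta>] density_tends_UNIV density_tends_empty
    by (intro density_tends_interleave) (auto simp: S'_def)
  also have "(\<Sum>s<M. if s \<in> R then 1 else if s \<in> N then \<delta> else 0) = \<alpha> * real M"
  proof -
    have "{1..Suc j} + B \<subseteq> {..<M}" using lt by (auto simp: set_plus_def)
    then have RM: "R \<subseteq> {..<M}" "N \<subseteq> {..<M}" using R_sub by (auto simp: N_def)
    have "(\<Sum>s<M. if s \<in> R then 1 else if s \<in> N then \<delta> else 0)
        = (\<Sum>s<M. if s \<in> R then 1 else 0) + (\<Sum>s<M. if s \<in> N then \<delta> else 0)"
      unfolding sum.distrib[symmetric] by (intro sum.cong) (auto simp: N_def)
    also have "\<dots> = real (card R) + real (card N) * \<delta>"
      using RM by (simp add: sum.If_cases Int_absorb1 flip: sum.inter_restrict)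
    also have "\<dots> = \<alpha> * real M" using N_pos by (simp add: \<delta>_def)
    finally show ?thesis .
  qed
  finally have dens: "density_tends (interleave M S + B) \<alpha>" using M sum by simp
  have "interleave M S \<subseteq> {0<..}"
    using M by (auto simp: interleave_def S_def intro!: Nat.gr0I)
  moreover have "ap_open (interleave M S)"
    using M ap_open_UNIV ap_open_empty ap_open_digit_set
    by (intro ap_open_interleave) (auto simp: S_def)
  ultimately show ?thesis using dens by (intro exI[of _ "interleave M S"] conjI)
qed

section \<open>Prescribed density with many or with no primes\<close>

text \<open>
  By the pigeonhole principle some residue class modulo \<open>M\<close> contains infinitely many primes. It
  is included completely, at a cost of \<open>1 / M \<le> \<alpha>\<close>, and the other classes are thinned out
  equally to make up the rest of \<open>\<alpha>\<close>.
\<close>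

lemma exists_ap_open_density_inf_primes:
  assumes \<alpha>: "0 < \<alpha>" "\<alpha> \<le> 1"
  shows "\<exists>A\<subseteq>{0<..}. ap_open A \<and> density_tends A \<alpha> \<and> infinite {p \<in> A. prime p}"
proof -
  obtain M0 :: nat where M0: "1 / \<alpha> < real M0" using reals_Archimedean2 by blast
  define M where "M = M0 + 2"
  have M: "0 < M" "1 < M" by (auto simp: M_def)
  have "1 / \<alpha> < real M" using M0 by (simp add: M_def)
  then have aM: "1 \<le> \<alpha> * real M" using \<alpha> by (simp add: field_simps)
  have "finite ((\<lambda>p. p mod M) ` {p::nat. prime p})"
    by (rule finite_subset[of _ "{..<M}"]) (use M in auto)
  then obtain p0 where "infinite {p \<in> {p::nat. prime p}. p mod M = p0 mod M}"
    using pigeonhole_infinite[OF primes_infinite] by blast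
  moreover define r where "r = p0 mod M"
  ultimately have r: "r < M" "infinite {p::nat. prime p \<and> p mod M = r}" using M by auto
  \<comment> \<open>The solution of \<open>1 + (M - 1) * \<delta> = \<alpha> * M\<close>.\<close>
  define \<delta> where "\<delta> = (\<alpha> * real M - 1) / (real M - 1)"
  have "\<alpha> * real M \<le> real M" using \<alpha> M by simp
  then have \<delta>: "0 \<le> \<delta>" "\<delta> \<le> 1" using aM M by (auto simp: \<delta>_def field_simps)
  define S where "S s = (if s = r then UNIV else digit_set \<delta>)" for s
  have "density_tends (interleave M S) ((\<Sum>s<M. if s = r then 1 else \<delta>) / real M)"
    using M density_tends_digit_set[OF \<delta>] density_tends_UNIV
    by (intro density_tends_interleave) (auto simp: S_def)
  also have "(\<Sum>s<M. if s = r then 1 else \<delta>) = \<alpha> * real M"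
  proof -
    have "(\<Sum>s<M. if s = r then 1 else \<delta>) = (\<Sum>s<M. (if s = r then 1 - \<delta> else 0) + \<delta>)"
      by (intro sum.cong) auto
    also have "\<dots> = 1 + (real M - 1) * \<delta>"
      using r(1) by (simp add: sum.distrib algebra_simps)
    also have "\<dots> = \<alpha> * real M" using M by (simp add: \<delta>_def)
    finally show ?thesis .
  qed
  finally have dens: "density_tends (interleave M S \<inter> {0<..}) \<alpha>"
    using M density_tends_Int_pos by simp
  have "{p. prime p \<and> p mod M = r} \<subseteq> {p \<in> interleave M S \<inter> {0<..}. prime p}"
    by (auto simp: interleave_def S_def prime_gt_0_nat)
  then have "infinite {p \<in> interleave M S \<inter> {0<..}. prime p}"
    using r(2) finite_subset by blast
  moreover have "ap_open (interleave M S \<inter> {0<..})"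
    using M ap_open_UNIV ap_open_digit_set
    by (intro ap_open_Int ap_open_interleave ap_open_pos) (auto simp: S_def)
  ultimately show ?thesis
    using dens by (intro exI[of _ "interleave M S \<inter> {0<..}"] conjI Int_lower2)
qed

text \<open>
  The proper multiples of a composite number \<open>n\<close> are composite, so the progression from \<open>n\<close> with
  difference \<open>n\<close> contains no prime.
\<close>

lemma ap_open_composites: "ap_open {n. 1 < n \<and> \<not> prime (n::nat)}"
  unfolding ap_open_def
proof
  fix n :: nat assume "n \<in> {n. 1 < n \<and> \<not> prime n}"
  then have n: "1 < n" "\<not> prime n" by auto
  have "n + i * n \<in> {n. 1 < n \<and> \<not> prime n}" for i
  proof -
    have eq: "n + i * n = n * Suc i" by simp
    have "\<not> prime (n * Suc i)" using n prime_product[of n "Suc i"] by auto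
    then show ?thesis using n by (simp only: eq mem_Collect_eq) (simp add: one_less_mult)
  qed
  then show "\<exists>d>0. \<forall>i. n + i * d \<in> {n. 1 < n \<and> \<not> prime n}"
    using n by (intro exI[of _ n]) auto
qed

lemma density_tends_Int_composites:
  assumes "density_tends A t"
  shows "density_tends (A \<inter> {n. 1 < n \<and> \<not> prime n}) t"
proof (rule density_tends_perturb[where f = "\<lambda>n. real (card (A \<inter> {1..n}))"
      and e = "\<lambda>n. real (card {p. prime p \<and> p \<le> n}) + 1"])
  show "(\<lambda>n. real (card (A \<inter> {1..n})) / real n) \<longlonglongrightarrow> t"
    using assms by (simp add: density_tends_def)
  have "(\<lambda>n. real (card {p. prime p \<and> p \<le> n}) / real n + 1 / real n) \<longlonglongrightarrow> 0 + 0"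
    by (intro tendsto_add primes_density_zero lim_const_over_n)
  then show "(\<lambda>n. (real (card {p. prime p \<and> p \<le> n}) + 1) / real n) \<longlonglongrightarrow> 0"
    by (simp add: add_divide_distrib)
next
  fix n
  let ?C = "A \<inter> {n. 1 < n \<and> \<not> prime n} \<inter> {1..n}" and ?P = "{p. prime p \<and> p \<le> n}"
  have finP: "finite ?P" by (rule finite_subset[of _ "{..n}"]) auto
  have "card ?C \<le> card (A \<inter> {1..n})"
    by (intro card_mono) auto
  moreover have "card (A \<inter> {1..n}) \<le> card (?C \<union> insert 1 ?P)"
    using finP by (intro card_mono) auto
  moreover have "\<dots> \<le> card ?C + card (insert 1 ?P)" by (rule card_Un_le)
  moreover have "card (insert 1 ?P) \<le> card ?P + 1"
    using finP by (simp add: card_insert_if)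
  ultimately show "\<bar>real (card ?C) - real (card (A \<inter> {1..n}))\<bar> \<le> real (card ?P) + 1"
    by linarith
qed

section \<open>The theorem\<close>

theorem theorem2p5:
  fixes B :: "nat set" and \<alpha> :: real
  assumes "B \<subseteq> {0<..}" and "B \<noteq> {}" and "finite B"
    and "0 < \<alpha>" and "\<alpha> \<le> 1"
  shows "(\<exists>A\<subseteq>{0<..}. union_of_disjoint_aps A \<and> has_density (A + B) \<alpha>) \<and>
    (\<exists>A\<subseteq>{0<..}. has_density A \<alpha> \<and> union_of_disjoint_aps A \<and>
       infinite {p \<in> A. prime p}) \<and>
    (\<exists>A\<subseteq>{0<..}. has_density A \<alpha> \<and> union_of_disjoint_aps A \<and>
       (\<forall>p\<in>A. \<not> prime p))"
proof (intro conjI)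
  have "\<exists>A\<subseteq>{0<..}. ap_open A \<and> density_tends (A + B) \<alpha>"
  proof (cases "\<alpha> = 1")
    \<comment> \<open>A modulus with room for all shifts exists only below \<open>1\<close>; for \<open>1\<close> take all positive integers.\<close>
    case True
    have "{0<..} + B = {Min B<..}"
    proof (rule set_eqI, rule iffI)
      fix x assume "x \<in> {0<..} + B"
      then obtain y b where "x = y + b" "0 < y" "b \<in> B" by (auto simp: set_plus_def)
      moreover from this have "Min B \<le> b" using assms(3) by simp
      ultimately show "x \<in> {Min B<..}" by simp
    next
      fix x assume "x \<in> {Min B<..}"
      then have "x = (x - Min B) + Min B" "0 < x - Min B" by auto
      then show "x \<in> {0<..} + B"
        using Min_in[OF assms(3,2)] unfolding set_plus_def by blast
    qed
    then show ?thesis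
      using True density_tends_greaterThan ap_open_pos by (intro exI[of _ "{0<..}"]) simp
  next
    case False
    then show ?thesis using assms by (intro exists_ap_open_sumset_density) auto
  qed
  then obtain A where A: "A \<subseteq> {0<..}" "ap_open A" "density_tends (A + B) \<alpha>" by blast
  have "A \<noteq> {}"
    using density_tends_nonempty[OF A(3) assms(4)] by (auto simp: set_plus_def)
  then show "\<exists>A\<subseteq>{0<..}. union_of_disjoint_aps A \<and> has_density (A + B) \<alpha>"
    using A union_of_disjoint_aps_if_ap_open has_density_if_density_tends by blast
next
  show "\<exists>A\<subseteq>{0<..}. has_density A \<alpha> \<and> union_of_disjoint_aps A \<and>
       infinite {p \<in> A. prime p}"
  proof -
    obtain A where A: "A \<subseteq> {0<..}" "ap_open A" "density_tends A \<alpha>" "infinite {p \<in> A. prime p}"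
      using exists_ap_open_density_inf_primes[OF assms(4,5)] by blast
    have "union_of_disjoint_aps A"
      using A(1,2) density_tends_nonempty[OF A(3) assms(4)]
      by (intro union_of_disjoint_aps_if_ap_open)
    then show ?thesis
      using A has_density_if_density_tends[OF A(3)] by (intro exI[of _ A] conjI)
  qed
next
  let ?A = "digit_set \<alpha> \<inter> {n. 1 < n \<and> \<not> prime n}"
  have dens: "density_tends ?A \<alpha>"
    using assms by (intro density_tends_Int_composites density_tends_digit_set) auto
  have "ap_open ?A" by (intro ap_open_Int ap_open_digit_set ap_open_composites)
  moreover have "?A \<subseteq> {0<..}" by auto
  ultimately have "union_of_disjoint_aps ?A"
    using density_tends_nonempty[OF dens assms(4)] by (intro union_of_disjoint_aps_if_ap_open)
  then show "\<exists>A\<subseteq>{0<..}. has_density A \<alpha> \<and> union_of_disjoint_aps A \<and>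
       (\<forall>p\<in>A. \<not> prime p)"
    using has_density_if_density_tends[OF dens] by (intro exI[of _ ?A]) auto
qed

end
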